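(* Assume that the following conjecture holds: for every $w$, every monotone width-$w$ DNF $f$ and every $\varepsilon>0$ there exists a monotone width-$w$ DNF $f_{upper}$ such that (i) $f(x)\le f_{upper}(x)$ for all $x$; (ii) $f_{upper}$ and $f$ are $\varepsilon$-close; (iii) $f_{upper}$ has size $(1/\varepsilon)^{O(w)}$. Then for any $r\ge 3$ there exists a constant $c_r$ such that the following holds for every $w\ge 2$: any $w$-set system $\mathcal{F}$ of size $|\mathcal{F}|\ge(\log w)^{c_r w}$ contains an $r$-sunflower.
   Context: A $w$-set system is a collection of (distinct) sets, each of size at most $w$. An $r$-sunflower is a family of $r$ (distinct) sets $S_1,\ldots,S_r$ all of whose pairwise intersections are the same; a set system contains an $r$-sunflower if some $r$ of its members form one. A DNF (disjunctive normal form) on variables $x_1,\dots,x_n$ is a disjunction of conjunctive terms. Its size is the number of terms, and its width is the maximal number of literals in a term. A $w$-set system corresponds to a monotone width-$w$ DNF, so "width-$w$" means that every term has at most $w$ literals. A DNF is monotone if it contains no negated variables. Two functions $f,g:\{0,1\}^n\to\{0,1\}$ are $\varepsilon$-close if $\Pr[f(x)\neq g(x)]\le\varepsilon$ over a uniformly chosen input $x\in\{0,1\}^n$. The constant hidden in $O(w)$ is absolute.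
   Formalization: The bound (log w)^{c_r w} is read with max(2, log_2 w) in place of log w, since at w = 2 the literal bound is 1 and a single set contains no r-sunflower; in the conjecture (1/ε)^{O(w)} is read as max(2, 1/ε)^{O(w)}, a weaker assumption. *)

theory Defs
  imports "HOL-Probability.Probability"
begin

datatype literal = Pos nat | Neg nat

fun lit_var :: "literal \<Rightarrow> nat" where
  "lit_var (Pos i) = i"
| "lit_var (Neg i) = i"

fun lit_eval :: "literal \<Rightarrow> (nat \<Rightarrow> bool) \<Rightarrow> bool" where
  "lit_eval (Pos i) x = x i"
| "lit_eval (Neg i) x = (\<not> x i)"

text \<open>A DNF is the set of its terms, a term the set of its literals. The empty DNF is the constant
  0, and a DNF containing the empty term is the constant 1.\<close>

type_synonym dnf = "literal set set"

definition dnf_on :: "nat \<Rightarrow> dnf \<Rightarrow> bool" where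
  "dnf_on n f \<longleftrightarrow> (\<forall>T\<in>f. lit_var ` T \<subseteq> {1..n})"

definition dnf_eval :: "dnf \<Rightarrow> (nat \<Rightarrow> bool) \<Rightarrow> bool" where
  "dnf_eval f x \<longleftrightarrow> (\<exists>T\<in>f. \<forall>l\<in>T. lit_eval l x)"

definition dnf_size :: "dnf \<Rightarrow> nat" where
  "dnf_size f = card f"

definition width_at_most :: "nat \<Rightarrow> dnf \<Rightarrow> bool" where
  "width_at_most w f \<longleftrightarrow> (\<forall>T\<in>f. card T \<le> w)"

definition monotone_dnf :: "dnf \<Rightarrow> bool" where
  "monotone_dnf f \<longleftrightarrow> (\<forall>T\<in>f. \<forall>i. Neg i \<notin> T)"

definition cube :: "nat \<Rightarrow> (nat \<Rightarrow> bool) set" where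
  "cube n = {1..n} \<rightarrow>\<^sub>E (UNIV :: bool set)"

definition eps_close ::
  "nat \<Rightarrow> real \<Rightarrow> ((nat \<Rightarrow> bool) \<Rightarrow> bool) \<Rightarrow> ((nat \<Rightarrow> bool) \<Rightarrow> bool) \<Rightarrow> bool" where
  "eps_close n \<epsilon> f g \<longleftrightarrow> measure_pmf.prob (pmf_of_set (cube n)) {x. f x \<noteq> g x} \<le> \<epsilon>"

text \<open>The size bound \<open>(1/\<epsilon>)\<^sup>O\<^sup>(\<^sup>w\<^sup>)\<close> is meant for \<open>\<epsilon>\<close> bounded away from 1. With the base
  \<open>1/\<epsilon>\<close> itself the conjecture would be false: for \<open>\<epsilon> > 1\<close> it would force size 0, and for \<open>\<epsilon>\<close> close to 1
  it would force size 1, which is impossible for two disjoint terms of \<open>w\<close> variables when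
  \<open>w\<close> is large and \<open>\<epsilon> = 1 - 2 / 2\<^sup>w\<close>. The base is therefore \<open>max 2 (1/\<epsilon>)\<close>, which
  is \<open>1/\<epsilon>\<close> for \<open>\<epsilon> \<le> 1/2\<close> and gives size \<open>2\<^sup>O\<^sup>(\<^sup>w\<^sup>)\<close> for larger \<open>\<epsilon>\<close>.\<close>

definition upper_compression_conjecture :: bool where
  "upper_compression_conjecture \<longleftrightarrow>
    (\<exists>C::real. \<forall>(w::nat) (n::nat) (f::dnf) (\<epsilon>::real).
       dnf_on n f \<and> monotone_dnf f \<and> width_at_most w f \<and> \<epsilon> > 0 \<longrightarrow>
       (\<exists>f_upper. dnf_on n f_upper \<and> monotone_dnf f_upper \<and> width_at_most w f_upper \<and>
          (\<forall>x\<in>cube n. dnf_eval f x \<le> dnf_eval f_upper x) \<and>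
          eps_close n \<epsilon> (dnf_eval f_upper) (dnf_eval f) \<and>
          real (dnf_size f_upper) \<le> max 2 (1 / \<epsilon>) powr (C * real w)))"

definition set_system :: "nat \<Rightarrow> 'a set set \<Rightarrow> bool" where
  "set_system w \<F> \<longleftrightarrow> finite \<F> \<and> (\<forall>S\<in>\<F>. finite S \<and> card S \<le> w)"

definition sunflower :: "nat \<Rightarrow> 'a set set \<Rightarrow> bool" where
  "sunflower r \<S> \<longleftrightarrow> finite \<S> \<and> card \<S> = r \<and> (\<exists>K. \<forall>A\<in>\<S>. \<forall>B\<in>\<S>. A \<noteq> B \<longrightarrow> A \<inter> B = K)"

definition contains_sunflower :: "nat \<Rightarrow> 'a set set \<Rightarrow> bool" where
  "contains_sunflower r \<F> \<longleftrightarrow> (\<exists>\<S>\<subseteq>\<F>. sunflower r \<S>)"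

text \<open>The base of the sunflower bound: \<open>log w\<close>, to base 2, but at least 2. Since \<open>log 2 2 = 1\<close>, the
  bound \<open>(log w)\<^sup>c\<^sup>w\<close> would be 1 at \<open>w = 2\<close> for every \<open>c\<close>, and a single set
  contains no sunflower. For \<open>w \<ge> 4\<close> this is \<open>log 2 w\<close>; for \<open>w = 3\<close> the difference is absorbed
  by the constant in the exponent, as \<open>log 2 3 > 1\<close>.\<close>

definition log_base :: "nat \<Rightarrow> real" where
  "log_base w = max 2 (log 2 (real w))"

end

theory Submission imports Defs begin

text \<open>
  The conjecture enters only through set systems: a monotone DNF is the family of the variable sets
  of its terms, and a compressed DNF is a small family \<open>H\<close> such that every member of the original
  family contains a member of \<open>H\<close>, while a random set is hardly more likely to contain a member of
  \<open>H\<close> than one of the original family.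

  The heart of the proof is that a spread family is satisfied by almost every set
  (\<open>spread_family_sat_prob\<close>). Here spread means that at most a fraction \<open>\<kappa>\<^sup>-\<^sup>|\<^sup>T\<^sup>|\<close> of the
  members contains a given nonempty set \<open>T\<close>, where \<open>\<kappa> = L\<^bsup>2C+2\<^esup>\<close> and
  \<open>C\<close> is the constant in the exponent of the conjecture. Compress a spread family of
  width \<open>w\<close> with error \<open>1/L\<close> and choose in every member a term of \<open>H\<close>. There are at most
  \<open>L\<^bsup>Cw\<^esup>\<close> terms, and a term with more than \<open>w/2\<close> elements is chosen by at most a fraction
  \<open>L\<^bsup>-(C+1)w\<^esup>\<close> of the members. Hence all but a fraction \<open>1/L\<close> of the members
  choose a term of size at most \<open>w/2\<close>. These terms form a family of half the width that is as spread
  as before, and passing to it costs a probability of \<open>1/L\<close>. After about \<open>log w\<close> rounds the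
  width is 0 and the family contains the empty set, which every set contains. So the original family
  is satisfied with probability at least \<open>1 - t/L\<close>, where \<open>t\<close> is the number of rounds, and it
  suffices that \<open>L\<close> is a large constant times \<open>log w\<close>.

  To obtain \<open>r\<close> disjoint members from uniform random bits, every element of the ground set gets
  \<open>r\<close> bits, and a member is replaced by the set of all bits of its elements. This multiplies the
  width by \<open>r\<close> and takes the \<open>r\<close>-th root of the spread parameter. The bits colour the ground set
  with subsets of \<open>{..<r}\<close>, and by symmetry each single colour is as likely to contain a member as the
  colour with all bits set. By a union bound over the \<open>r\<close> colours \<open>{j}\<close>, some colouring
  has a monochromatic member in each of them (\<open>disjoint_members_if_sat_prob\<close>).

  Finally, a large set system has a spread link: choose \<open>K\<close> maximizing the number of members
  above \<open>K\<close> times \<open>\<kappa>\<^sup>|\<^sup>K\<^sup>|\<close> (\<open>spread_link_exists\<close>). Disjoint members of the link of \<open>K\<close>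
  are the petals of a sunflower with core \<open>K\<close>.
\<close>

section \<open>Compression of set families\<close>

definition sat_prob :: "'b set \<Rightarrow> 'b set set \<Rightarrow> real" where
  "sat_prob U G = real (card {X \<in> Pow U. \<exists>A\<in>G. A \<subseteq> X}) / 2 ^ card U"

text \<open>The conjecture for monotone DNFs with the variable set \<open>U\<close>. The ground set is arbitrary because the
  conjecture is applied to sets of pairs.\<close>

definition compressible :: "real \<Rightarrow> 'b set \<Rightarrow> bool" where
  "compressible C U \<longleftrightarrow>
    (\<forall>w G \<epsilon>. (\<forall>A\<in>G. A \<subseteq> U \<and> card A \<le> w) \<longrightarrow> \<epsilon> > 0 \<longrightarrow>
      (\<exists>H. (\<forall>B\<in>H. B \<subseteq> U \<and> card B \<le> w) \<and> (\<forall>A\<in>G. \<exists>B\<in>H. B \<subseteq> A) \<and>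
           sat_prob U H \<le> sat_prob U G + \<epsilon> \<and>
           real (card H) \<le> max 2 (1 / \<epsilon>) powr (C * real w)))"

lemma compressibleE:
  assumes "compressible C U" "\<epsilon> > 0" "\<And>A. A \<in> G \<Longrightarrow> A \<subseteq> U \<and> card A \<le> w"
  obtains H where "\<forall>B\<in>H. B \<subseteq> U \<and> card B \<le> w" "\<forall>A\<in>G. \<exists>B\<in>H. B \<subseteq> A"
    "sat_prob U H \<le> sat_prob U G + \<epsilon>"
    "real (card H) \<le> max 2 (1 / \<epsilon>) powr (C * real w)"
  using assms(1)[unfolded compressible_def, rule_format, of G w \<epsilon>] assms(2,3) by blast

lemma sat_prob_mono:
  assumes "finite U" "\<And>A. A \<in> G \<Longrightarrow> \<exists>B\<in>H. B \<subseteq> A"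
  shows "sat_prob U G \<le> sat_prob U H"
proof -
  have "card {X \<in> Pow U. \<exists>A\<in>G. A \<subseteq> X} \<le> card {X \<in> Pow U. \<exists>B\<in>H. B \<subseteq> X}"
  proof (rule card_mono)
    show "{X \<in> Pow U. \<exists>A\<in>G. A \<subseteq> X} \<subseteq> {X \<in> Pow U. \<exists>B\<in>H. B \<subseteq> X}"
    proof
      fix X assume "X \<in> {X \<in> Pow U. \<exists>A\<in>G. A \<subseteq> X}"
      then obtain A where X: "X \<in> Pow U" and A: "A \<in> G" "A \<subseteq> X" by blast
      obtain B where "B \<in> H" "B \<subseteq> A" using assms(2)[OF A(1)] by blast
      then show "X \<in> {X \<in> Pow U. \<exists>B\<in>H. B \<subseteq> X}" using X A(2) by blast
    qed
  qed (use assms(1) in simp)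
  then show ?thesis
    by (simp add: sat_prob_def divide_right_mono)
qed

lemma sat_prob_empty_set:
  assumes "finite U" "{} \<in> G"
  shows "sat_prob U G = 1"
proof -
  have "{X \<in> Pow U. \<exists>A\<in>G. A \<subseteq> X} = Pow U" using assms by auto
  then show ?thesis using assms by (simp add: sat_prob_def card_Pow)
qed

lemma sat_prob_image:
  assumes h: "bij_betw h U V" and G: "\<And>A. A \<in> G \<Longrightarrow> A \<subseteq> U"
  shows "sat_prob V ((`) h ` G) = sat_prob U G"
proof -
  have "bij_betw ((`) h) (Pow U) (Pow V)"
    using h by (rule bij_betw_Pow)
  then have inj: "inj_on ((`) h) (Pow U)" and im: "(`) h ` Pow U = Pow V"
    by (auto simp: bij_betw_def)
  have sub: "h ` A \<subseteq> h ` X \<longleftrightarrow> A \<subseteq> X" if "A \<subseteq> U" "X \<subseteq> U" for A X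
  proof
    assume AX: "h ` A \<subseteq> h ` X"
    show "A \<subseteq> X"
    proof
      fix a assume a: "a \<in> A"
      then have "h a \<in> h ` X" using AX by blast
      then show "a \<in> X"
        using a that inj_on_image_mem_iff[OF bij_betw_imp_inj_on[OF h], of a X] by blast
    qed
  qed (rule image_mono)
  have "{Y \<in> Pow V. \<exists>A\<in>(`) h ` G. A \<subseteq> Y} = (`) h ` {X \<in> Pow U. \<exists>A\<in>G. A \<subseteq> X}"
  proof (intro equalityI subsetI)
    fix Y assume "Y \<in> {Y \<in> Pow V. \<exists>A\<in>(`) h ` G. A \<subseteq> Y}"
    then obtain A where A: "A \<in> G" "h ` A \<subseteq> Y" and "Y \<in> Pow V" by blast
    then obtain X where X: "X \<in> Pow U" "Y = h ` X" unfolding im[symmetric] by blast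
    then have "A \<subseteq> X" using A sub[OF G[OF A(1)]] by simp
    then show "Y \<in> (`) h ` {X \<in> Pow U. \<exists>A\<in>G. A \<subseteq> X}" using A(1) X by blast
  next
    fix Y assume "Y \<in> (`) h ` {X \<in> Pow U. \<exists>A\<in>G. A \<subseteq> X}"
    then obtain X A where X: "X \<in> Pow U" "Y = h ` X" and A: "A \<in> G" "A \<subseteq> X" by blast
    have "Y \<in> Pow V" unfolding im[symmetric] X(2) using X(1) by (rule imageI)
    moreover have "h ` A \<in> (`) h ` G" using A(1) by (rule imageI)
    moreover have "h ` A \<subseteq> Y" unfolding X(2) using A(2) by (rule image_mono)
    ultimately show "Y \<in> {Y \<in> Pow V. \<exists>A\<in>(`) h ` G. A \<subseteq> Y}" by blast
  qed
  moreover have "inj_on ((`) h) {X \<in> Pow U. \<exists>A\<in>G. A \<subseteq> X}"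
    using inj by (rule inj_on_subset) auto
  ultimately show ?thesis
    using bij_betw_same_card[OF h] by (simp add: sat_prob_def card_image)
qed

text \<open>Renaming the variables moves the conjecture from \<open>{1..n}\<close> to any finite set.\<close>

lemma compressible_bij:
  assumes h: "bij_betw h U V" and V: "compressible C V" and "finite U"
  shows "compressible C U"
  unfolding compressible_def
proof (intro allI impI)
  fix w :: nat and G and \<epsilon> :: real
  assume G: "\<forall>A\<in>G. A \<subseteq> U \<and> card A \<le> w" and e: "\<epsilon> > 0"
  have hU: "h ` U = V" and inj: "inj_on h U" using h by (auto simp: bij_betw_def)
  have "A \<subseteq> V \<and> card A \<le> w" if "A \<in> (`) h ` G" for A
    using that G hU inj by (auto simp: card_image inj_on_subset)
  with V e obtain H where H: "\<forall>B\<in>H. B \<subseteq> V \<and> card B \<le> w"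
    and cover: "\<forall>A\<in>(`) h ` G. \<exists>B\<in>H. B \<subseteq> A"
    and close: "sat_prob V H \<le> sat_prob V ((`) h ` G) + \<epsilon>"
    and size: "real (card H) \<le> max 2 (1 / \<epsilon>) powr (C * real w)"
    by (rule compressibleE)
  define g where "g = inv_into U h"
  have g: "bij_betw g V U" unfolding g_def using h by (rule bij_betw_inv_into)
  have gh: "g ` h ` A = A" if "A \<subseteq> U" for A
    unfolding g_def using inj that by (rule inv_into_image_cancel)
  have finV: "finite V" using hU \<open>finite U\<close> by auto
  have "H \<subseteq> Pow V" using H by auto
  then have finH: "finite H" using finV by (simp add: finite_subset)
  show "\<exists>H. (\<forall>B\<in>H. B \<subseteq> U \<and> card B \<le> w) \<and> (\<forall>A\<in>G. \<exists>B\<in>H. B \<subseteq> A) \<and>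
           sat_prob U H \<le> sat_prob U G + \<epsilon> \<and>
           real (card H) \<le> max 2 (1 / \<epsilon>) powr (C * real w)"
  proof (intro exI[of _ "(`) g ` H"] conjI)
    show "\<forall>B\<in>(`) g ` H. B \<subseteq> U \<and> card B \<le> w"
      using H g by (auto simp: bij_betw_def card_image inj_on_subset)
    show "\<forall>A\<in>G. \<exists>B\<in>(`) g ` H. B \<subseteq> A"
    proof
      fix A assume "A \<in> G"
      then obtain B where "B \<in> H" "B \<subseteq> h ` A" using cover by auto
      then have "g ` B \<subseteq> A" using gh[of A] G \<open>A \<in> G\<close> image_mono[of B "h ` A" g] by auto
      then show "\<exists>B\<in>(`) g ` H. B \<subseteq> A" using \<open>B \<in> H\<close> by blast
    qed
    show "sat_prob U ((`) g ` H) \<le> sat_prob U G + \<epsilon>"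
      using close sat_prob_image[OF h, of G] sat_prob_image[OF g, of H] G H by auto
    show "real (card ((`) g ` H)) \<le> max 2 (1 / \<epsilon>) powr (C * real w)"
      using size card_image_le[OF finH, of "(`) g"] by linarith
  qed
qed

lemma monotone_term_eval:
  assumes "\<forall>i. Neg i \<notin> T" "lit_var ` T \<subseteq> {1..n}"
  shows "(\<forall>l\<in>T. lit_eval l (restrict (\<lambda>i. i \<in> X) {1..n})) \<longleftrightarrow> {i. Pos i \<in> T} \<subseteq> X"
proof -
  have vars: "i \<in> {1..n}" if "Pos i \<in> T" for i
    using assms(2) imageI[OF that, of lit_var] by auto
  show ?thesis
  proof
    assume eval: "\<forall>l\<in>T. lit_eval l (restrict (\<lambda>i. i \<in> X) {1..n})"
    show "{i. Pos i \<in> T} \<subseteq> X"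
    proof
      fix i assume "i \<in> {i. Pos i \<in> T}"
      then show "i \<in> X" using bspec[OF eval, of "Pos i"] vars[of i] by simp
    qed
  next
    assume X: "{i. Pos i \<in> T} \<subseteq> X"
    show "\<forall>l\<in>T. lit_eval l (restrict (\<lambda>i. i \<in> X) {1..n})"
    proof
      fix l assume l: "l \<in> T"
      then obtain i where i: "l = Pos i" using assms(1) by (cases l) auto
      then have "i \<in> X" using l X by blast
      then show "lit_eval l (restrict (\<lambda>i. i \<in> X) {1..n})" using vars[of i] l i by simp
    qed
  qed
qed

lemma monotone_dnf_eval:
  assumes "monotone_dnf f" "dnf_on n f"
  shows "dnf_eval f (restrict (\<lambda>i. i \<in> X) {1..n}) \<longleftrightarrow>
           (\<exists>B\<in>(\<lambda>T. {i. Pos i \<in> T}) ` f. B \<subseteq> X)"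
proof -
  have "(\<forall>l\<in>T. lit_eval l (restrict (\<lambda>i. i \<in> X) {1..n})) \<longleftrightarrow> {i. Pos i \<in> T} \<subseteq> X" if "T \<in> f" for T
    using assms that by (intro monotone_term_eval) (auto simp: monotone_dnf_def dnf_on_def)
  then show ?thesis by (simp add: dnf_eval_def cong: bex_cong)
qed

lemma bij_betw_Pow_cube:
  "bij_betw (\<lambda>X. restrict (\<lambda>i. i \<in> X) {1..n}) (Pow {1..n}) (cube n)"
  by (rule bij_betw_byWitness[where f' = "\<lambda>x. {i \<in> {1..n}. x i}"])
    (auto simp: cube_def fun_eq_iff PiE_def extensional_def)

text \<open>The two functions differ only where the upper one is true and the lower one is false, so
  closeness turns into a bound on the increase of the satisfaction probability. The exponent is made
  nonnegative so that the spread parameter \<open>L powr (2 * C + 2)\<close> exceeds 1.\<close>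

lemma compressible_if_conjecture:
  assumes "upper_compression_conjecture"
  shows "\<exists>C\<ge>0. \<forall>n::nat. compressible C {1..n}"
proof -
  obtain C0 where C0: "\<And>(w::nat) (n::nat) (f::dnf) (\<epsilon>::real).
       dnf_on n f \<Longrightarrow> monotone_dnf f \<Longrightarrow> width_at_most w f \<Longrightarrow> \<epsilon> > 0 \<Longrightarrow>
       (\<exists>f_upper. dnf_on n f_upper \<and> monotone_dnf f_upper \<and> width_at_most w f_upper \<and>
          (\<forall>x\<in>cube n. dnf_eval f x \<le> dnf_eval f_upper x) \<and>
          eps_close n \<epsilon> (dnf_eval f_upper) (dnf_eval f) \<and>
          real (dnf_size f_upper) \<le> max 2 (1 / \<epsilon>) powr (C0 * real w))"
    using assms unfolding upper_compression_conjecture_def by metis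
  have "compressible (max C0 0) {1..n}" for n :: nat
    unfolding compressible_def
  proof (intro allI impI)
    fix w :: nat and G :: "nat set set" and \<epsilon> :: real
    assume G: "\<forall>A\<in>G. A \<subseteq> {1..n} \<and> card A \<le> w" and e: "\<epsilon> > 0"
    define f where "f = (`) Pos ` G"
    have f: "dnf_on n f" "monotone_dnf f" "width_at_most w f"
      using G by (fastforce simp: f_def dnf_on_def monotone_dnf_def width_at_most_def card_image inj_on_def)+
    obtain fu where fu: "dnf_on n fu" "monotone_dnf fu" "width_at_most w fu"
      and le: "\<And>x. x \<in> cube n \<Longrightarrow> dnf_eval f x \<Longrightarrow> dnf_eval fu x"
      and close: "eps_close n \<epsilon> (dnf_eval fu) (dnf_eval f)"
      and size: "real (dnf_size fu) \<le> max 2 (1 / \<epsilon>) powr (C0 * real w)"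
      using C0[OF f e] by auto
    define vars where "vars T = {i. Pos i \<in> T}" for T
    define H where "H = vars ` fu"
    define ch where "ch X = restrict (\<lambda>i. i \<in> X) {1..n}" for X
    have bij: "bij_betw ch (Pow {1..n}) (cube n)"
      unfolding ch_def by (rule bij_betw_Pow_cube)
    have "vars (Pos ` A) = A" for A by (auto simp: vars_def)
    then have "vars ` f = G" by (simp add: f_def image_image)
    then have evf: "dnf_eval f (ch X) \<longleftrightarrow> (\<exists>A\<in>G. A \<subseteq> X)" for X
      using monotone_dnf_eval[OF f(2,1), of X] by (simp add: vars_def ch_def)
    have evu: "dnf_eval fu (ch X) \<longleftrightarrow> (\<exists>B\<in>H. B \<subseteq> X)" for X
      using monotone_dnf_eval[OF fu(2,1), of X] by (simp add: H_def vars_def ch_def)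
    have fu_pos: "T = Pos ` vars T" if "T \<in> fu" for T
    proof -
      have "l \<in> Pos ` vars T" if "l \<in> T" for l
        using fu(2) \<open>T \<in> fu\<close> that by (cases l) (auto simp: monotone_dnf_def vars_def)
      then show ?thesis by (auto simp: vars_def)
    qed
    have card_vars: "card (vars T) = card T" if "T \<in> fu" for T
      by (subst (2) fu_pos[OF that]) (simp add: card_image inj_on_def)
    have vars_sub: "vars T \<subseteq> {1..n}" if "T \<in> fu" for T
      using fu(1) that by (force simp: dnf_on_def vars_def)
    have "fu \<subseteq> (`) Pos ` Pow {1..n}"
      using fu_pos vars_sub by blast
    then have fin: "finite fu" by (rule finite_subset) simp
    have fincube: "finite (cube n)" and necube: "cube n \<noteq> {}"
      and cardcube: "card (cube n) = 2 ^ n"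
      using bij_betw_finite[OF bij] bij bij_betw_same_card[OF bij]
      by (auto simp: card_Pow bij_betw_def)
    define P where "P K = {X \<in> Pow {1..n}. \<exists>A\<in>K. A \<subseteq> X}" for K
    have "sat_prob {1..n} H \<le> sat_prob {1..n} G + \<epsilon>"
    proof -
      have finP: "finite (P K)" for K by (simp add: P_def)
      have "real (card (P H)) \<le> real (card (P G)) + real (card (P H - P G))"
      proof -
        have "card (P H) \<le> card (P G \<union> (P H - P G))" by (rule card_mono) (auto simp: finP)
        also have "\<dots> \<le> card (P G) + card (P H - P G)" by (rule card_Un_le)
        finally show ?thesis by simp
      qed
      moreover have "inj_on ch (P H - P G)"
        by (rule inj_on_subset[OF bij_betw_imp_inj_on[OF bij]]) (auto simp: P_def)
      then have "card (P H - P G) = card (ch ` (P H - P G))"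
        by (simp add: card_image)
      moreover have "ch ` (P H - P G) \<subseteq> cube n \<inter> {x. dnf_eval fu x \<noteq> dnf_eval f x}"
        using bij evf evu by (auto simp: bij_betw_def P_def)
      then have "card (ch ` (P H - P G)) \<le> card (cube n \<inter> {x. dnf_eval fu x \<noteq> dnf_eval f x})"
        using fincube by (intro card_mono) auto
      moreover have "real (card (cube n \<inter> {x. dnf_eval fu x \<noteq> dnf_eval f x})) \<le> \<epsilon> * 2 ^ n"
        using close unfolding eps_close_def measure_pmf_of_set[OF necube fincube] cardcube
        by (simp add: field_simps)
      ultimately have "real (card (P H)) \<le> real (card (P G)) + \<epsilon> * 2 ^ n" by linarith
      then show ?thesis
        by (simp add: sat_prob_def P_def field_simps)
    qed
    moreover have "\<exists>B\<in>H. B \<subseteq> A" if "A \<in> G" for A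
    proof -
      have "ch A \<in> cube n" using bij G that by (auto simp: bij_betw_def)
      then show ?thesis using le[of "ch A"] evf[of A] evu[of A] that by auto
    qed
    moreover have "real (card H) \<le> max 2 (1 / \<epsilon>) powr (max C0 0 * real w)"
    proof -
      have "real (card H) \<le> real (dnf_size fu)"
        unfolding H_def dnf_size_def using fin by (simp add: card_image_le)
      also note size
      also have "max 2 (1 / \<epsilon>) powr (C0 * real w) \<le> max 2 (1 / \<epsilon>) powr (max C0 0 * real w)"
        by (intro powr_mono mult_right_mono) auto
      finally show ?thesis .
    qed
    moreover have "\<forall>B\<in>H. B \<subseteq> {1..n} \<and> card B \<le> w"
      using vars_sub card_vars fu(3) by (auto simp: H_def width_at_most_def)
    ultimately show "\<exists>H. (\<forall>B\<in>H. B \<subseteq> {1..n} \<and> card B \<le> w) \<and> (\<forall>A\<in>G. \<exists>B\<in>H. B \<subseteq> A) \<and>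
           sat_prob {1..n} H \<le> sat_prob {1..n} G + \<epsilon> \<and>
           real (card H) \<le> max 2 (1 / \<epsilon>) powr (max C0 0 * real w)"
      by blast
  qed
  then show ?thesis by (intro exI[of _ "max C0 0"]) auto
qed

section \<open>Spread families are satisfied by most sets\<close>

text \<open>
  Each round of the induction on \<open>t\<close> compresses the family and halves its width. The family is
  indexed, since different members may choose the same term and the count must be kept with
  multiplicity. The spread bound refers to a fixed number \<open>N\<close> rather than to the current number of
  indices: in this form it is inherited when indices are dropped and the sets \<open>\<phi> i\<close> shrink. At
  most \<open>N / L\<close> indices are lost in each round, so the lower bound on \<open>card I\<close> keeps at least
  one index alive until the width is 0.
\<close>

lemma spread_family_sat_prob:
  fixes U :: "'b set" and \<phi> :: "'i \<Rightarrow> 'b set" and C L N :: real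
  assumes U: "finite U" "compressible C U" and C: "C \<ge> 0" and L: "L \<ge> 2" and N: "N \<ge> 0"
    and I: "finite I" "\<And>i. i \<in> I \<Longrightarrow> \<phi> i \<subseteq> U" "\<And>i. i \<in> I \<Longrightarrow> card (\<phi> i) \<le> w"
    and spread: "\<And>T. T \<subseteq> U \<Longrightarrow> T \<noteq> {} \<Longrightarrow>
      real (card {i \<in> I. T \<subseteq> \<phi> i}) \<le> N * L powr (- (2 * C + 2) * real (card T))"
    and w: "w < 2 ^ t" and large: "real (card I) > N * real t / L"
  shows "sat_prob U (\<phi> ` I) \<ge> 1 - real t / L"
  using I spread w large
proof (induction t arbitrary: w I \<phi>)
  case 0
  then obtain i where "i \<in> I" by fastforce
  moreover have "\<phi> i = {}"
    using 0 \<open>i \<in> I\<close> U(1) by (metis card_0_eq finite_subset le_zero_eq less_one power_0)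
  ultimately have "{} \<in> \<phi> ` I" by force
  then show ?case using sat_prob_empty_set[OF U(1)] by simp
next
  case (Suc t)
  have ts: "N * real t / L + N / L < real (card I)"
    using Suc.prems(6) by (simp add: algebra_simps add_divide_distrib)
  show ?case
  proof (cases "w = 0")
    case True
    have "card I \<noteq> 0"
      using Suc.prems(6) N L by (metis divide_nonneg_nonneg mult_nonneg_nonneg not_less of_nat_0 of_nat_0_le_iff order_trans zero_le_numeral)
    then obtain i where "i \<in> I" by fastforce
    moreover have "\<phi> i = {}"
      using Suc.prems(2,3) True \<open>i \<in> I\<close> U(1) by (metis card_0_eq finite_subset le_zero_eq)
    ultimately have "{} \<in> \<phi> ` I" by force
    then show ?thesis using sat_prob_empty_set[OF U(1)] L by simp
  next
    case False
    \<comment> \<open>With error \<open>1 / L\<close>, where \<open>L \<ge> 2\<close>, the base of the size bound is \<open>L\<close>.\<close>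
    have "1 / L > 0" "\<And>A. A \<in> \<phi> ` I \<Longrightarrow> A \<subseteq> U \<and> card A \<le> w"
      using Suc.prems(2,3) L by auto
    with U(2) obtain H where H: "\<forall>B\<in>H. B \<subseteq> U \<and> card B \<le> w"
      and cover: "\<forall>A\<in>\<phi> ` I. \<exists>B\<in>H. B \<subseteq> A"
      and close: "sat_prob U H \<le> sat_prob U (\<phi> ` I) + 1 / L"
      and size: "real (card H) \<le> max 2 (1 / (1 / L)) powr (C * real w)"
      by (rule compressibleE)
    have size: "real (card H) \<le> L powr (C * real w)"
      using size L by (simp add: max_def)
    have "H \<subseteq> Pow U" using H by auto
    then have finH: "finite H" using U(1) by (simp add: finite_subset)
    have "\<forall>i\<in>I. \<exists>B. B \<in> H \<and> B \<subseteq> \<phi> i" using cover by blast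
    from bchoice[OF this] obtain \<psi>
      where psi: "\<And>i. i \<in> I \<Longrightarrow> \<psi> i \<in> H" "\<And>i. i \<in> I \<Longrightarrow> \<psi> i \<subseteq> \<phi> i"
      by blast
    define I' where "I' = {i \<in> I. card (\<psi> i) \<le> w div 2}"
    \<comment> \<open>The terms that are too long for the next round; few indices lie above each of them.\<close>
    define D where "D = {B \<in> H. w div 2 < card B}"
    have finD: "finite D" "card D \<le> card H"
      using finH by (auto simp: D_def intro: card_mono)
    have "I - I' \<subseteq> (\<Union>B\<in>D. {i \<in> I. B \<subseteq> \<phi> i})"
    proof
      fix i assume "i \<in> I - I'"
      then have "i \<in> I" "\<psi> i \<in> D" using psi(1) by (auto simp: I'_def D_def not_le)
      then show "i \<in> (\<Union>B\<in>D. {i \<in> I. B \<subseteq> \<phi> i})" using psi(2) by blast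
    qed
    then have "card (I - I') \<le> card (\<Union>B\<in>D. {i \<in> I. B \<subseteq> \<phi> i})"
      using finD Suc.prems(1) by (intro card_mono) auto
    also have "\<dots> \<le> (\<Sum>B\<in>D. card {i \<in> I. B \<subseteq> \<phi> i})"
      using finD(1) by (rule card_UN_le)
    finally have "real (card (I - I')) \<le> real (\<Sum>B\<in>D. card {i \<in> I. B \<subseteq> \<phi> i})"
      by (rule of_nat_mono)
    also have "\<dots> = (\<Sum>B\<in>D. real (card {i \<in> I. B \<subseteq> \<phi> i}))" by (rule of_nat_sum)
    also have "\<dots> \<le> (\<Sum>B\<in>D. N * L powr (- (C + 1) * real w))"
    proof (rule sum_mono)
      fix B assume B: "B \<in> D"
      then have "B \<subseteq> U" "B \<noteq> {}" using H by (auto simp: D_def)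
      then have "real (card {i \<in> I. B \<subseteq> \<phi> i}) \<le> N * L powr (- (2 * C + 2) * real (card B))"
        by (rule Suc.prems(4))
      also have "real w \<le> 2 * real (card B)" using B unfolding D_def by simp linarith
      then have "(C + 1) * real w \<le> (C + 1) * (2 * real (card B))"
        using C by (intro mult_left_mono) auto
      then have "N * L powr (- (2 * C + 2) * real (card B)) \<le> N * L powr (- (C + 1) * real w)"
        using N L by (intro mult_left_mono powr_mono) (auto simp: algebra_simps)
      finally show "real (card {i \<in> I. B \<subseteq> \<phi> i}) \<le> N * L powr (- (C + 1) * real w)" .
    qed
    also have "\<dots> = real (card D) * (N * L powr (- (C + 1) * real w))" by simp
    also have "\<dots> \<le> L powr (C * real w) * (N * L powr (- (C + 1) * real w))"
      using N finD(2) size by (intro mult_right_mono) auto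
    also have "\<dots> = N * L powr (- real w)"
      by (simp add: powr_add[symmetric] algebra_simps)
    \<comment> \<open>The width is positive, so a single factor \<open>1 / L\<close> can be kept.\<close>
    also have "\<dots> \<le> N * L powr (- 1)"
      using N L False by (intro mult_left_mono powr_mono) auto
    also have "\<dots> = N / L" using L by (simp add: powr_minus_divide)
    finally have "real (card (I - I')) \<le> N / L" .
    moreover have "card I = card I' + card (I - I')"
      using card_Un_disjoint[of I' "I - I'"] Suc.prems(1)
      by (simp add: I'_def Un_absorb1 Collect_conj_eq)
    ultimately have large: "N * real t / L < real (card I')" using ts by linarith
    have "1 - real t / L \<le> sat_prob U (\<psi> ` I')"
    proof (rule Suc.IH)
      show "finite I'" using Suc.prems(1) by (simp add: I'_def)
      show "\<psi> i \<subseteq> U" if "i \<in> I'" for i using that psi H by (auto simp: I'_def)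
      show "card (\<psi> i) \<le> w div 2" if "i \<in> I'" for i using that by (simp add: I'_def)
      show "real (card {i \<in> I'. T \<subseteq> \<psi> i}) \<le> N * L powr (- (2 * C + 2) * real (card T))"
        if "T \<subseteq> U" "T \<noteq> {}" for T
      proof -
        have "card {i \<in> I'. T \<subseteq> \<psi> i} \<le> card {i \<in> I. T \<subseteq> \<phi> i}"
          using Suc.prems(1) psi by (intro card_mono) (auto simp: I'_def)
        then show ?thesis using Suc.prems(4)[OF that] by linarith
      qed
      show "w div 2 < 2 ^ t" using Suc.prems(5) by auto
    qed (fact large)
    also have "\<dots> \<le> sat_prob U H"
      by (rule sat_prob_mono[OF U(1)]) (use psi in \<open>auto simp: I'_def\<close>)
    finally show ?thesis using close by (simp add: add_divide_distrib)
  qed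
qed

section \<open>Disjoint members from a random colouring\<close>

text \<open>A subset \<open>X\<close> of \<open>V \<times> {..<r}\<close> colours \<open>v\<close> with the set of all \<open>i\<close> such that
  \<open>(v, i) \<in> X\<close>. Flipping all bits except the \<open>j\<close>-th ones is an involution on colourings that
  exchanges the colours \<open>{j}\<close> and \<open>{..<r}\<close>.\<close>

lemma card_monochromatic:
  assumes j: "j < r" and S: "\<And>S. S \<in> F \<Longrightarrow> S \<subseteq> V"
  shows "card {X \<in> Pow (V \<times> {..<r}). \<exists>S\<in>F. \<forall>v\<in>S. {i. (v, i) \<in> X} = {j}}
       = card {X \<in> Pow (V \<times> {..<r}). \<exists>A\<in>(\<lambda>S. S \<times> {..<r}) ` F. A \<subseteq> X}"
proof -
  define D where "D = V \<times> ({..<r} - {j})"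
  define flip where "flip X = (X - D) \<union> (D - X)" for X
  have ff: "flip (flip X) = X" for X by (auto simp: flip_def)
  have sub: "flip X \<subseteq> V \<times> {..<r}" if "X \<subseteq> V \<times> {..<r}" for X
    using that by (auto simp: flip_def D_def)
  have mono: "(\<forall>v\<in>S. {i. (v, i) \<in> flip X} = {j}) \<longleftrightarrow> S \<times> {..<r} \<subseteq> X"
    if X: "X \<subseteq> V \<times> {..<r}" and SV: "S \<subseteq> V" for S X
  proof -
    have "{i. (v, i) \<in> flip X} = {j} \<longleftrightarrow> (\<forall>i<r. (v, i) \<in> X)" if "v \<in> S" for v
    proof -
      have v: "v \<in> V" using that SV by auto
      have "{i. (v, i) \<in> flip X} = {j} \<longleftrightarrow> (\<forall>i<r. (v, i) \<in> flip X \<longleftrightarrow> i = j)"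
      proof -
        have "i < r" if "(v, i) \<in> flip X" for i using sub[OF X] that by blast
        then show ?thesis using j by blast
      qed
      also have "\<dots> \<longleftrightarrow> (\<forall>i<r. (v, i) \<in> X)"
        using v by (auto simp: flip_def D_def)
      finally show ?thesis .
    qed
    then show ?thesis by auto
  qed
  define P where "P X \<longleftrightarrow> (\<exists>A\<in>(\<lambda>S. S \<times> {..<r}) ` F. A \<subseteq> X)" for X
  define Q where "Q X \<longleftrightarrow> (\<exists>S\<in>F. \<forall>v\<in>S. {i. (v, i) \<in> X} = {j})" for X
  have QP: "Q (flip X) \<longleftrightarrow> P X" if X: "X \<subseteq> V \<times> {..<r}" for X
  proof -
    have "Q (flip X) \<longleftrightarrow> (\<exists>S\<in>F. S \<times> {..<r} \<subseteq> X)"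
      unfolding Q_def by (rule bex_cong[OF refl mono[OF X S]])
    then show ?thesis unfolding P_def by simp
  qed
  have PQ: "P (flip X) \<longleftrightarrow> Q X" if "X \<subseteq> V \<times> {..<r}" for X
    using QP[OF sub[OF that]] by (simp add: ff)
  have "bij_betw flip {X \<in> Pow (V \<times> {..<r}). P X} {X \<in> Pow (V \<times> {..<r}). Q X}"
  proof (rule bij_betw_byWitness[where f' = flip])
    show "flip ` {X \<in> Pow (V \<times> {..<r}). P X} \<subseteq> {X \<in> Pow (V \<times> {..<r}). Q X}"
      by (intro image_subsetI) (simp add: QP sub)
    show "flip ` {X \<in> Pow (V \<times> {..<r}). Q X} \<subseteq> {X \<in> Pow (V \<times> {..<r}). P X}"
      by (intro image_subsetI) (simp add: PQ sub)
  qed (simp_all add: ff)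
  then show ?thesis unfolding P_def Q_def by (rule bij_betw_same_card[symmetric])
qed

text \<open>For each \<open>j < r\<close>, fewer than a fraction \<open>1 / r\<close> of the colourings have no member of
  colour \<open>{j}\<close>. So some colouring has members of all \<open>r\<close> colours, and sets of different
  colours are disjoint.\<close>

lemma disjoint_members_if_sat_prob:
  assumes V: "finite V" and F: "\<And>S. S \<in> F \<Longrightarrow> S \<subseteq> V"
    and p: "sat_prob (V \<times> {..<r}) ((\<lambda>S. S \<times> {..<r}) ` F) > 1 - 1 / real r"
  shows "\<exists>s. (\<forall>j<r. s j \<in> F) \<and> (\<forall>i<r. \<forall>j<r. i \<noteq> j \<longrightarrow> s i \<inter> s j = {})"
proof (cases "r = 0")
  case False
  define U where "U = V \<times> {..<r}"
  have finU: "finite U" using V by (simp add: U_def)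
  define good where "good j = {X \<in> Pow U. \<exists>S\<in>F. \<forall>v\<in>S. {i. (v, i) \<in> X} = {j}}" for j
  have card_good: "real (card (good j)) > (1 - 1 / real r) * 2 ^ card U" if "j < r" for j
    using p card_monochromatic[OF that F] unfolding good_def sat_prob_def U_def[symmetric]
    by (simp add: field_simps)
  have "card (\<Union>j<r. Pow U - good j) \<le> (\<Sum>j<r. card (Pow U - good j))"
    by (rule card_UN_le) simp
  then have "real (card (\<Union>j<r. Pow U - good j)) \<le> (\<Sum>j<r. real (card (Pow U - good j)))"
    by (simp flip: of_nat_sum)
  also have "\<dots> < (\<Sum>j<r. 2 ^ card U / real r)"
  proof (rule sum_strict_mono)
    fix j assume "j \<in> {..<r}"
    have "good j \<subseteq> Pow U" by (auto simp: good_def)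
    then have "real (card (Pow U - good j)) = 2 ^ card U - real (card (good j))"
      using finU by (subst card_Diff_subset) (auto simp: card_Pow finite_subset of_nat_diff dest: card_mono[rotated])
    then show "real (card (Pow U - good j)) < 2 ^ card U / real r"
      using card_good[of j] \<open>j \<in> {..<r}\<close> by (simp add: algebra_simps)
  qed (use False in auto)
  also have "\<dots> = real (card (Pow U))" using False finU by (simp add: card_Pow)
  finally have "(\<Union>j<r. Pow U - good j) \<noteq> Pow U" by auto
  then obtain X where "\<forall>j<r. X \<in> good j" by auto
  then have "\<forall>j<r. \<exists>S\<in>F. \<forall>v\<in>S. {i. (v, i) \<in> X} = {j}" by (auto simp: good_def)
  then obtain s where s: "\<And>j. j < r \<Longrightarrow> s j \<in> F"
    "\<And>j v. j < r \<Longrightarrow> v \<in> s j \<Longrightarrow> {i. (v, i) \<in> X} = {j}"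
    by metis
  have "s i \<inter> s j = {}" if "i < r" "j < r" "i \<noteq> j" for i j
    using s(2)[OF that(1)] s(2)[OF that(2)] that(3) by blast
  then show ?thesis using s(1) by blast
qed auto

section \<open>Sunflowers in large set systems\<close>

text \<open>Let \<open>m K\<close> be the number of members above \<open>K\<close> times \<open>\<kappa> ^ card K\<close>. For
  \<open>K\<close> maximizing \<open>m K\<close>, the spread inequality is \<open>m (K \<union> T) \<le> m K\<close>. Comparison
  with the empty set gives \<open>m K > \<kappa> ^ w\<close>, which a single member of size at most \<open>w\<close>
  above \<open>K\<close> cannot reach.\<close>

lemma spread_link_exists:
  fixes \<F> :: "'a set set" and \<kappa> :: real
  assumes F: "set_system w \<F>" and k: "\<kappa> \<ge> 1" and large: "real (card \<F>) > \<kappa> ^ w"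
  shows "\<exists>K. card {S \<in> \<F>. K \<subseteq> S} \<ge> 2 \<and>
    (\<forall>T. T \<inter> K = {} \<longrightarrow>
      real (card {S \<in> \<F>. K \<union> T \<subseteq> S}) * \<kappa> ^ card T \<le> real (card {S \<in> \<F>. K \<subseteq> S}))"
proof -
  define V where "V = \<Union>\<F>"
  have fin: "finite \<F>" "finite V" using F by (auto simp: set_system_def V_def)
  define m where "m K = real (card {S \<in> \<F>. K \<subseteq> S}) * \<kappa> ^ card K" for K
  obtain K where K: "K \<in> Pow V" and max: "\<And>K'. K' \<in> Pow V \<Longrightarrow> m K' \<le> m K"
  proof -
    have "Max (m ` Pow V) \<in> m ` Pow V" using fin by (intro Max_in) auto
    then obtain K where "K \<in> Pow V" "m K = Max (m ` Pow V)" by (metis imageE)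
    then show ?thesis using fin by (intro that[of K]) auto
  qed
  have finK: "finite K" using K fin by (auto intro: finite_subset)
  have mK: "m K > \<kappa> ^ w"
    using max[of "{}"] large by (simp add: m_def)
  have "card {S \<in> \<F>. K \<subseteq> S} \<ge> 2"
  proof (rule ccontr)
    assume "\<not> ?thesis"
    then have le1: "card {S \<in> \<F>. K \<subseteq> S} \<le> 1" by simp
    have "m K > 0" using mK k by (meson less_trans zero_less_one zero_less_power less_le_trans)
    then have "{S \<in> \<F>. K \<subseteq> S} \<noteq> {}" by (auto simp: m_def simp del: Collect_empty_eq)
    then obtain S where S: "S \<in> \<F>" "K \<subseteq> S" by auto
    then have "card K \<le> w" using F unfolding set_system_def by (meson card_mono order_trans)
    then have "\<kappa> ^ card K \<le> \<kappa> ^ w" using k by (rule power_increasing)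
    moreover have "m K \<le> 1 * \<kappa> ^ card K"
      unfolding m_def using le1 k by (intro mult_right_mono) auto
    ultimately show False using mK by simp
  qed
  moreover have "real (card {S \<in> \<F>. K \<union> T \<subseteq> S}) * \<kappa> ^ card T \<le> real (card {S \<in> \<F>. K \<subseteq> S})"
    if T: "T \<inter> K = {}" for T
  proof (cases "T \<subseteq> V")
    case True
    then have "card (K \<union> T) = card K + card T"
      using T fin finK by (subst card_Un_disjoint) (auto intro: finite_subset)
    then have "real (card {S \<in> \<F>. K \<union> T \<subseteq> S}) * \<kappa> ^ card T * \<kappa> ^ card K
        \<le> real (card {S \<in> \<F>. K \<subseteq> S}) * \<kappa> ^ card K"
      using max[of "K \<union> T"] K True by (simp add: m_def power_add ac_simps)
    then show ?thesis using k by simp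
  next
    case False
    then have empty: "{S \<in> \<F>. K \<union> T \<subseteq> S} = {}" by (auto simp: V_def)
    show ?thesis unfolding empty by simp
  qed
  ultimately show ?thesis by blast
qed

lemma contains_sunflower_if_disjoint_petals:
  assumes s: "\<forall>j<r. s j \<in> \<F>" "\<forall>j<r. K \<subset> s j"
    and dis: "\<forall>i<r. \<forall>j<r. i \<noteq> j \<longrightarrow> (s i - K) \<inter> (s j - K) = {}"
  shows "contains_sunflower r \<F>"
proof -
  have "inj_on s {..<r}"
  proof (rule inj_onI, rule ccontr)
    fix i j assume "i \<in> {..<r}" "j \<in> {..<r}" "s i = s j" "i \<noteq> j"
    then have "s i - K = {}" using dis by auto
    then show False using s(2) \<open>i \<in> {..<r}\<close> by auto
  qed
  then have "card (s ` {..<r}) = r" by (simp add: card_image)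
  moreover have "A \<inter> B = K" if AB: "A \<in> s ` {..<r}" "B \<in> s ` {..<r}" "A \<noteq> B" for A B
  proof -
    obtain i j where "i < r" "j < r" "A = s i" "B = s j" "i \<noteq> j" using AB by auto
    then have "(A - K) \<inter> (B - K) = {}" "K \<subseteq> A" "K \<subseteq> B" using dis s(2) by auto
    then show ?thesis by auto
  qed
  ultimately have "sunflower r (s ` {..<r})" by (auto simp: sunflower_def)
  moreover have "s ` {..<r} \<subseteq> \<F>" using s(1) by auto
  ultimately show ?thesis unfolding contains_sunflower_def by blast
qed

text \<open>The spread link provides \<open>\<kappa>\<close> as the \<open>r\<close>-th power of what the halving argument
  needs: a set \<open>T\<close> of bits belongs to at least \<open>card T / r\<close> different elements.\<close>

lemma sunflower_if_compressible:
  fixes \<F> :: "'a set set" and C L :: real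
  assumes comp: "\<And>U :: ('a \<times> nat) set. finite U \<Longrightarrow> compressible C U" and C: "C \<ge> 0"
    and r: "r \<ge> 2" and F: "set_system w \<F>"
    and t: "r * w < 2 ^ t" and L: "L \<ge> 2" "2 * real r * real t \<le> L"
    and large: "real (card \<F>) > L powr ((2 * C + 2) * real r * real w)"
  shows "contains_sunflower r \<F>"
proof -
  define \<kappa> where "\<kappa> = L powr ((2 * C + 2) * real r)"
  have k: "\<kappa> \<ge> 1" using L C by (simp add: \<kappa>_def ge_one_powr_ge_zero)
  have "\<kappa> ^ w < real (card \<F>)"
    using large L by (simp add: \<kappa>_def powr_realpow[symmetric] powr_powr)
  then obtain K where K2: "card {S \<in> \<F>. K \<subseteq> S} \<ge> 2"
    and spr: "\<And>T. T \<inter> K = {} \<Longrightarrow>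
      real (card {S \<in> \<F>. K \<union> T \<subseteq> S}) * \<kappa> ^ card T \<le> real (card {S \<in> \<F>. K \<subseteq> S})"
    using spread_link_exists[OF F k] by blast
  define N where "N = real (card {S \<in> \<F>. K \<subseteq> S})"
  \<comment> \<open>The core itself is left out, since an empty petal would be disjoint from itself.\<close>
  define I where "I = {S \<in> \<F>. K \<subset> S}"
  define V where "V = \<Union>\<F>"
  define U where "U = V \<times> {..<r}"
  define \<phi> where "\<phi> S = (S - K) \<times> {..<r}" for S
  have fin: "finite \<F>" "finite V" "\<And>S. S \<in> \<F> \<Longrightarrow> finite S"
    using F by (auto simp: set_system_def V_def)
  have finI: "finite I" using fin by (simp add: I_def)
  have finU: "finite U" using fin by (simp add: U_def)
  have N2: "N \<ge> 2" using K2 by (simp add: N_def)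
  have "1 - real t / L \<le> sat_prob U (\<phi> ` I)"
  proof (rule spread_family_sat_prob[OF finU comp[OF finU] C L(1) _ finI _ _ _ t, of N])
    show "N \<ge> 0" using N2 by simp
    show "\<phi> S \<subseteq> U" if "S \<in> I" for S using that by (auto simp: \<phi>_def U_def V_def I_def)
    show "card (\<phi> S) \<le> r * w" if "S \<in> I" for S
    proof -
      have "card (S - K) \<le> card S"
        using that fin by (intro card_mono) (auto simp: I_def)
      also have "\<dots> \<le> w" using that F by (auto simp: I_def set_system_def)
      finally show ?thesis by (simp add: \<phi>_def card_cartesian_product mult.commute)
    qed
    show "real (card {S \<in> I. T \<subseteq> \<phi> S}) \<le> N * L powr (- (2 * C + 2) * real (card T))"
      if T: "T \<subseteq> U" "T \<noteq> {}" for T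
    proof (cases "fst ` T \<inter> K = {}")
      case True
      have finT: "finite T" using T finU finite_subset by blast
      have "T \<subseteq> fst ` T \<times> {..<r}" using T by (force simp: U_def)
      then have "card T \<le> card (fst ` T \<times> {..<r})"
        using finT by (intro card_mono) auto
      then have cT: "real (card T) \<le> real r * real (card (fst ` T))"
        by (simp add: card_cartesian_product mult.commute flip: of_nat_mult)
      have "(2 * C + 2) * real (card T) \<le> (2 * C + 2) * (real r * real (card (fst ` T)))"
        using C by (intro mult_left_mono[OF cT]) auto
      then have "L powr ((2 * C + 2) * real (card T)) \<le> \<kappa> ^ card (fst ` T)"
        using L by (simp add: \<kappa>_def powr_realpow[symmetric] powr_powr mult.assoc)
      moreover have "card {S \<in> I. T \<subseteq> \<phi> S} \<le> card {S \<in> \<F>. K \<union> fst ` T \<subseteq> S}"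
        using fin by (intro card_mono) (auto simp: I_def \<phi>_def)
      ultimately have "real (card {S \<in> I. T \<subseteq> \<phi> S}) * L powr ((2 * C + 2) * real (card T))
          \<le> real (card {S \<in> \<F>. K \<union> fst ` T \<subseteq> S}) * \<kappa> ^ card (fst ` T)"
        by (intro mult_mono) auto
      also have "\<dots> \<le> N" unfolding N_def using True by (rule spr)
      finally have "real (card {S \<in> I. T \<subseteq> \<phi> S}) \<le> N / L powr ((2 * C + 2) * real (card T))"
        using L by (simp add: pos_le_divide_eq)
      then show ?thesis
        by (simp only: powr_minus divide_inverse mult_minus_left)
    next
      case False
      then have "{S \<in> I. T \<subseteq> \<phi> S} = {}" by (fastforce simp: \<phi>_def)
      then show ?thesis using N2 by (simp only: card.empty) simp
    qed
    have "{S \<in> \<F>. K \<subseteq> S} \<subseteq> insert K I" by (auto simp: I_def)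
    then have "card {S \<in> \<F>. K \<subseteq> S} \<le> card (insert K I)"
      using finI by (intro card_mono) auto
    also have "\<dots> \<le> Suc (card I)" by (rule card_insert_le_m1) auto
    finally have "N - 1 \<le> real (card I)" by (simp add: N_def)
    \<comment> \<open>As \<open>N \<ge> 2\<close>, leaving out one index still keeps \<open>N / 2\<close>, twice what is needed.\<close>
    moreover have "4 * real t \<le> 2 * real r * real t" using r by (intro mult_right_mono) auto
    then have "real t / L \<le> 1 / 4" using L by (simp add: field_simps)
    then have "N * (real t / L) \<le> N * (1 / 4)" using N2 by (intro mult_left_mono) auto
    then have "N * real t / L \<le> N / 4" by simp
    ultimately show "N * real t / L < real (card I)" using N2 by linarith
  qed
  moreover have "real t / L < 1 / real r"
  proof -
    have "2 * (real r * real t) \<le> L" using L(2) by (simp only: mult.assoc)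
    then have "real r * real t < L" using L(1) by linarith
    then show ?thesis using L r by (simp add: field_simps)
  qed
  ultimately have "sat_prob U (\<phi> ` I) > 1 - 1 / real r" by linarith
  moreover have "\<phi> ` I = (\<lambda>S. S \<times> {..<r}) ` ((\<lambda>S. S - K) ` I)"
    by (auto simp: \<phi>_def image_image)
  ultimately obtain s where s: "\<forall>j<r. s j \<in> (\<lambda>S. S - K) ` I"
    and dis: "\<forall>i<r. \<forall>j<r. i \<noteq> j \<longrightarrow> s i \<inter> s j = {}"
    using disjoint_members_if_sat_prob[OF fin(2), of "(\<lambda>S. S - K) ` I" r]
    unfolding U_def by (force simp: I_def V_def)
  from s have "\<forall>j. \<exists>S. j < r \<longrightarrow> S \<in> I \<and> s j = S - K" by auto
  then obtain S where S: "\<And>j. j < r \<Longrightarrow> S j \<in> I \<and> s j = S j - K" by metis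
  show ?thesis
    by (rule contains_sunflower_if_disjoint_petals[of r S \<F> K]) (use S dis in \<open>auto simp: I_def\<close>)
qed

theorem theorem1p6:
  fixes r :: nat
  assumes "upper_compression_conjecture"
    and "r \<ge> 3"
  shows "\<exists>c::real. \<forall>w::nat. w \<ge> 2 \<longrightarrow>
           (\<forall>\<F> :: 'a set set. set_system w \<F> \<and> real (card \<F>) \<ge> log_base w powr (c * real w)
              \<longrightarrow> contains_sunflower r \<F>)"
proof -
  obtain C where C: "C \<ge> 0" and nat: "\<And>n::nat. compressible C {1..n}"
    using compressible_if_conjecture[OF assms(1)] by auto
  have comp: "compressible C U" if U: "finite U" for U :: "('a \<times> nat) set"
  proof -
    obtain h where "bij_betw h U {1..card U}"
      using finite_same_card_bij[OF U, of "{1..card U}"] by auto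
    then show ?thesis using nat U by (rule compressible_bij)
  qed
  \<comment> \<open>With \<open>b = log_base w\<close>, the number of rounds is at most \<open>(r + 2) b\<close>, so \<open>L\<close> has to be
    at least \<open>M b\<close>. As \<open>b \<ge> 2\<close>, the power \<open>b powr a\<close> suffices. The summand 1 in
    \<open>c\<close> makes the bound on \<open>card \<F>\<close> strict.\<close>
  define M where "M = 2 * real r * (real r + 2)"
  have M: "M \<ge> 2" unfolding M_def using assms(2) by (intro order_trans[OF _ mult_mono[of 2 "2 * real r" 1]]) auto
  define a where "a = 1 + log 2 M"
  define c where "c = a * ((2 * C + 2) * real r) + 1"
  have a: "a \<ge> 1" using M by (simp add: a_def)
  have "contains_sunflower r \<F>"
    if w: "w \<ge> 2" and F: "set_system w \<F>" and large: "real (card \<F>) \<ge> log_base w powr (c * real w)"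
    for w and \<F> :: "'a set set"
  proof -
    define b where "b = log_base w"
    have b: "b \<ge> 2" "b \<ge> log 2 (real w)" by (auto simp: b_def log_base_def)
    \<comment> \<open>The two summands account for \<open>r < 2 ^ r\<close> and for \<open>w\<close>.\<close>
    define t where "t = r + (nat \<lfloor>log 2 (real w)\<rfloor> + 1)"
    have "real w = 2 powr log 2 (real w)" using w by simp
    also have "\<dots> < 2 powr real (nat \<lfloor>log 2 (real w)\<rfloor> + 1)"
      using w by (intro powr_less_mono) linarith+
    also have "\<dots> = real (2 ^ (nat \<lfloor>log 2 (real w)\<rfloor> + 1))" by (subst powr_realpow) auto
    finally have "w < 2 ^ (nat \<lfloor>log 2 (real w)\<rfloor> + 1)" by (simp only: of_nat_less_iff)
    then have t: "r * w < 2 ^ t"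
      unfolding t_def power_add[of _ r] by (intro mult_strict_mono) (auto simp: less_exp)
    have "log 2 (real w) \<ge> 0" using w by simp
    then have "real t \<le> real r + (b + 1)" unfolding t_def using b(2) by simp linarith
    also have "\<dots> \<le> real r * b + (b + b)" using b(1) assms(2) by (intro add_mono) auto
    finally have tb: "real t \<le> (real r + 2) * b" by (simp add: algebra_simps)
    have "M = 2 powr log 2 M" using M by simp
    also have "\<dots> \<le> b powr log 2 M" using b M by (intro powr_mono2) auto
    finally have Mb: "M \<le> b powr log 2 M" .
    have "2 * real r * real t \<le> 2 * real r * ((real r + 2) * b)"
      using tb by (intro mult_left_mono) auto
    also have "\<dots> = b * M" by (simp add: M_def)
    also have "\<dots> \<le> b * b powr log 2 M" using Mb b by (intro mult_left_mono) auto
    also have "\<dots> = b powr a" using b by (simp add: a_def powr_add)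
    finally have Lt: "2 * real r * real t \<le> b powr a" .
    have L2: "b powr a \<ge> 2"
      using b powr_mono[OF a, of b] by simp
    have "(b powr a) powr ((2 * C + 2) * real r * real w) = b powr (a * ((2 * C + 2) * real r) * real w)"
      by (simp add: powr_powr mult.assoc)
    also have "\<dots> < b powr (c * real w)"
      using b w by (intro powr_less_mono) (auto simp: c_def)
    also have "\<dots> \<le> real (card \<F>)" using large by (simp add: b_def)
    finally show ?thesis
      using assms(2) by (intro sunflower_if_compressible[OF comp C _ F t L2 Lt]) auto
  qed
  then show ?thesis by blast
qed

end
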